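(* Let $\mu$ be a positive rational number and let $a_0\ne0$. For every integer $n\ge1$ consider the fractional differential equation (on $x>0$) $$(x^\mu+1)\,{}^CD_x^\mu y(x)-\Gamma(1+\mu)\,y(x)=0\quad\text{for }n=1,$$ $$x^{2\mu}\left({}^CD_x^\mu\right)^2y(x)+2(x^\mu+1)\,{}^CD_x^\mu y(x)-\frac{\Gamma(\mu)\left[\Gamma(\mu)+2B(1+\mu(n-2),\mu)\right]}{B(1+\mu(n-1),\mu)B(1+\mu(n-2),\mu)}\,y(x)=0\quad\text{for }n\ge2.$$ It has a solution which is a polynomial in $x^\mu$ of degree $n$, $y_{B,m_\mu}(x)=\sum_{\nu=0}^na_\nu x^{\mu\nu}$, where $a_1=a_0$ for $n=1$, and for $n\ge2$ $$a_1=\frac{a_0}{2\mu}\,\frac{\Gamma(\mu)+2B(1+\mu(n-2),\mu)}{B(1+\mu(n-1),\mu)B(1+\mu(n-2),\mu)},$$ $$a_2=\frac{\Gamma(\mu)^2\left(\Gamma(\mu)+2B(1+\mu(n-2),\mu)\right)\left(\Gamma(\mu)+2\mu B(1+\mu(n-2),\mu)\left[\frac1\mu-B(1+\mu(n-1),\mu)\right]\right)}{4\Gamma(1+2\mu)B(1+\mu(n-1),\mu)^2B(1+\mu(n-2),\mu)^2}\,a_0,$$ and, for $3\le\nu\le n$, $$a_\nu=a_2\prod_{j=2}^{\nu-1}\frac{B(1+\mu j,\mu)}{2}\left[\frac{\Gamma(\mu)+2B(1+\mu(n-2),\mu)}{B(1+\mu(n-1),\mu)B(1+\mu(n-2),\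mu)}-\frac{\Gamma(\mu)+2B(1+\mu(j-2),\mu)}{B(1+\mu(j-1),\mu)B(1+\mu(j-2),\mu)}\right].$$
   Context: $\Gamma$ is the Gamma function and $B(\cdot,\cdot)$ the beta function, $B(a,b)=\Gamma(a)\Gamma(b)/\Gamma(a+b)$. ${}^CD_x^\mu$ is the Caputo fractional derivative with base point $0$: for $x>0$, ${}^CD_x^\mu f(x)=\frac{1}{\Gamma(N-\mu)}\int_0^x\frac{f^{(N)}(\tau)}{(x-\tau)^{\mu+1-N}}\,d\tau$ if $N-1<\mu<N\in\mathbb{N}$, and ${}^CD_x^Nf=\frac{d^N}{dx^N}f$ if $\mu=N\in\mathbb{N}$. $({}^CD_x^\mu)^2$ means ${}^CD_x^\mu$ applied twice. *)

theory Defs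
  imports "HOL-Analysis.Analysis" "HOL-Computational_Algebra.Polynomial"
begin

text \<open>
  The Caputo derivative of order \<open>\<mu> > 0\<close> with base point \<open>0\<close>. The integer \<open>\<lceil>\<mu>\<rceil>\<close> is the \<open>N\<close> with
  \<open>N - 1 < \<mu> < N\<close> or \<open>\<mu> = N\<close>. The integral is a Lebesgue integral over the open interval, so only
  the values of \<open>f\<close> on the positive reals matter.
\<close>

definition caputo_kernel :: "real \<Rightarrow> (real \<Rightarrow> real) \<Rightarrow> real \<Rightarrow> real \<Rightarrow> real" where
  "caputo_kernel \<mu> f x \<tau> =
     (deriv ^^ nat \<lceil>\<mu>\<rceil>) f \<tau> / (x - \<tau>) powr (\<mu> + 1 - real (nat \<lceil>\<mu>\<rceil>))"

definition caputo :: "real \<Rightarrow> (real \<Rightarrow> real) \<Rightarrow> real \<Rightarrow> real" where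
  "caputo \<mu> f x =
     (if \<mu> = real (nat \<lceil>\<mu>\<rceil>) then (deriv ^^ nat \<lceil>\<mu>\<rceil>) f x
      else 1 / Gamma (real (nat \<lceil>\<mu>\<rceil>) - \<mu>) * (LINT \<tau>:{0<..<x}|lborel. caputo_kernel \<mu> f x \<tau>))"

text \<open>
  Since \<^const>\<open>deriv\<close> and the Lebesgue integral are total functions, the fact that \<open>caputo \<mu> f x\<close> is
  meaningful for all \<open>x > 0\<close> has to be stated separately.
\<close>

definition caputo_differentiable :: "real \<Rightarrow> (real \<Rightarrow> real) \<Rightarrow> bool" where
  "caputo_differentiable \<mu> f \<longleftrightarrow>
     (\<forall>k<nat \<lceil>\<mu>\<rceil>. \<forall>x>0. (deriv ^^ k) f field_differentiable (at x)) \<and>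
     (\<mu> \<noteq> real (nat \<lceil>\<mu>\<rceil>) \<longrightarrow> (\<forall>x>0. set_integrable lborel {0<..<x} (caputo_kernel \<mu> f x)))"

lemma caputo_of_nat: "caputo (real N) f x = (deriv ^^ N) f x"
  by (simp add: caputo_def)

lemma caputo_fractional:
  assumes "1 \<le> N" "real N - 1 < \<mu>" "\<mu> < real N"
  shows "caputo \<mu> f x =
    1 / Gamma (real N - \<mu>) *
      (LINT \<tau>:{0<..<x}|lborel. (deriv ^^ N) f \<tau> / (x - \<tau>) powr (\<mu> + 1 - real N))"
proof -
  have "\<lceil>\<mu>\<rceil> = int N"
    using assms by (intro ceiling_unique) auto
  then show ?thesis
    using assms by (simp add: caputo_def caputo_kernel_def [abs_def])
qed

text \<open>Meant for \<open>k \<ge> 2\<close>; used below both with \<open>k = n\<close> and with \<open>k = j\<close>.\<close>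

definition bessel_quot :: "real \<Rightarrow> nat \<Rightarrow> real" where
  "bessel_quot \<mu> k =
     (Gamma \<mu> + 2 * Beta (1 + \<mu> * (real k - 2)) \<mu>) /
     (Beta (1 + \<mu> * (real k - 1)) \<mu> * Beta (1 + \<mu> * (real k - 2)) \<mu>)"

definition bessel_coeff2 :: "real \<Rightarrow> nat \<Rightarrow> real \<Rightarrow> real" where
  "bessel_coeff2 \<mu> n a0 =
     (Gamma \<mu>)\<^sup>2 * (Gamma \<mu> + 2 * Beta (1 + \<mu> * (real n - 2)) \<mu>) *
     (Gamma \<mu> + 2 * \<mu> * Beta (1 + \<mu> * (real n - 2)) \<mu> *
        (1 / \<mu> - Beta (1 + \<mu> * (real n - 1)) \<mu>)) /
     (4 * Gamma (1 + 2 * \<mu>) *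
        (Beta (1 + \<mu> * (real n - 1)) \<mu>)\<^sup>2 * (Beta (1 + \<mu> * (real n - 2)) \<mu>)\<^sup>2) * a0"

text \<open>Meant for \<open>\<nu> \<le> n\<close> and \<open>n \<ge> 1\<close>.\<close>

definition bessel_coeff :: "real \<Rightarrow> nat \<Rightarrow> real \<Rightarrow> nat \<Rightarrow> real" where
  "bessel_coeff \<mu> n a0 \<nu> =
     (if \<nu> = 0 then a0
      else if \<nu> = 1 then (if n = 1 then a0 else a0 / (2 * \<mu>) * bessel_quot \<mu> n)
      else if \<nu> = 2 then bessel_coeff2 \<mu> n a0
      else bessel_coeff2 \<mu> n a0 *
        (\<Prod>j=2..\<nu>-1. Beta (1 + \<mu> * real j) \<mu> / 2 * (bessel_quot \<mu> n - bessel_quot \<mu> j)))"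

definition frac_bessel :: "real \<Rightarrow> nat \<Rightarrow> real \<Rightarrow> real \<Rightarrow> real" where
  "frac_bessel \<mu> n a0 x = (\<Sum>\<nu>=0..n. bessel_coeff \<mu> n a0 \<nu> * x powr (\<mu> * real \<nu>))"

end

theory Submission
  imports Defs
begin

text \<open>
  Write \<open>D\<close> for the Caputo derivative and \<open>r j = \<Gamma>(1 + \<mu>j) / \<Gamma>(1 + \<mu>(j-1))\<close>. The Beta integral gives
  \<open>D x\<^bsup>\<mu>j\<^esup> = r j x\<^bsup>\<mu>(j-1)\<^esup>\<close> for \<open>j \<ge> 1\<close>, and \<open>D 1 = 0\<close>. Since \<open>\<Gamma>(\<mu>) / B(1 + \<mu>j, \<mu>) = r (j + 1)\<close>, the
  coefficient of \<open>y\<close> in the equation for \<open>n \<ge> 2\<close> is \<open>\<lambda> n\<close> with \<open>\<lambda> j = r j r (j - 1) + 2 r j\<close>, and comparing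
  coefficients turns the equation into \<open>2 r (j + 1) a (j + 1) = (\<lambda> n - \<lambda> j) a j\<close>, which the given closed
  forms satisfy. The degree is exactly \<open>n\<close> because \<open>\<lambda>\<close> is strictly increasing, by strict log-convexity
  of the Gamma function.
\<close>

section \<open>Caputo derivatives of sums of real powers\<close>

text \<open>The product \<open>pochhammer (e i - real k) (Suc k)\<close> is the falling factorial
  e(e-1)...(e-k). One induction serves both claims: the derivative claim for k yields the value
  formula for k + 1 on all positive reals, an open set, so it can be differentiated again
  there.\<close>

lemma higher_deriv_sum_powr:
  fixes c e :: "'i \<Rightarrow> real"
  assumes "finite A" and f: "\<And>x. x > 0 \<Longrightarrow> f x = (\<Sum>i\<in>A. c i * x powr e i)" and "x > 0"
  shows "((deriv ^^ k) f has_field_derivative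
           (\<Sum>i\<in>A. c i * pochhammer (e i - real k) (Suc k) * x powr (e i - real (Suc k)))) (at x)"
    and "(deriv ^^ k) f x = (\<Sum>i\<in>A. c i * pochhammer (e i + 1 - real k) k * x powr (e i - real k))"
  using \<open>x > 0\<close>
proof (induction k arbitrary: x)
  case 0
  { case 1
    have "((\<lambda>x. \<Sum>i\<in>A. c i * x powr e i) has_field_derivative
            (\<Sum>i\<in>A. c i * (e i * x powr (e i - 1)))) (at x)"
      using 1 by (auto intro!: derivative_eq_intros sum.cong)
    moreover have "\<forall>\<^sub>F t in nhds x. f t = (\<Sum>i\<in>A. c i * t powr e i)"
      using eventually_nhds_in_open[of "{0<..}" x] 1 by (auto elim!: eventually_mono simp: f)
    ultimately show ?case
      by (subst funpow_0, subst DERIV_cong_ev[OF refl _ refl]) (auto simp: mult_ac)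
  next
    case 2
    then show ?case by (simp add: f)
  }
next
  case (Suc k)
  have val: "(deriv ^^ Suc k) f x
      = (\<Sum>i\<in>A. c i * pochhammer (e i - real k) (Suc k) * x powr (e i - real (Suc k)))"
    if "x > 0" for x
    using DERIV_imp_deriv[OF Suc.IH(1)[OF that]] by simp
  { case 1
    have "((\<lambda>x. \<Sum>i\<in>A. c i * pochhammer (e i - real k) (Suc k) * x powr (e i - real (Suc k)))
        has_field_derivative
          (\<Sum>i\<in>A. c i * pochhammer (e i - real k) (Suc k) *
             ((e i - real (Suc k)) * x powr (e i - real (Suc k) - 1)))) (at x)"
      using 1 by (auto intro!: derivative_eq_intros sum.cong)
    moreover have "(\<Sum>i\<in>A. c i * pochhammer (e i - real k) (Suc k) *
             ((e i - real (Suc k)) * x powr (e i - real (Suc k) - 1)))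
        = (\<Sum>i\<in>A. c i * pochhammer (e i - real (Suc k)) (Suc (Suc k)) *
             x powr (e i - real (Suc (Suc k))))"
    proof (intro sum.cong refl)
      fix i
      have "e i - real (Suc k) - 1 = e i - real (Suc (Suc k))" "e i - real (Suc k) + 1 = e i - real k"
        by simp_all
      then show "c i * pochhammer (e i - real k) (Suc k) *
             ((e i - real (Suc k)) * x powr (e i - real (Suc k) - 1))
          = c i * pochhammer (e i - real (Suc k)) (Suc (Suc k)) *
             x powr (e i - real (Suc (Suc k)))"
        by (simp only: pochhammer_rec[of "e i - real (Suc k)" "Suc k"] mult_ac)
    qed
    moreover have "\<forall>\<^sub>F t in nhds x. (deriv ^^ Suc k) f t =
        (\<Sum>i\<in>A. c i * pochhammer (e i - real k) (Suc k) * t powr (e i - real (Suc k)))"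
    proof (rule eventually_mono)
      show "\<forall>\<^sub>F t in nhds x. t \<in> {0<..}"
        using 1 by (intro eventually_nhds_in_open) auto
    qed (use val in auto)
    ultimately show ?case
      by (simp only: DERIV_cong_ev[OF refl _ refl])
  next
    case 2
    show ?case unfolding val[OF 2] by simp
  }
qed

text \<open>Substituting t = x s leads to the Beta integral on the unit interval. The
  \<open>has_bochner_integral\<close> form carries both integrability, for
  \<open>caputo_differentiable\<close>, and the value, for \<open>caputo\<close>.\<close>

lemma has_bochner_integral_Beta_scaled:
  fixes a b x :: real
  assumes "a > 0" "b > 0" "x > 0"
  shows "has_bochner_integral lborel
           (\<lambda>t. indicator {0<..<x} t *\<^sub>R (t powr (a - 1) * (x - t) powr (b - 1)))
           (x powr (a + b - 1) * Beta a b)"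
proof -
  have int: "set_integrable lborel {0..1} (\<lambda>t. t powr (a - 1) * (1 - t) powr (b - 1))"
    using assms by (intro integrable_Beta)
  have "integral {0..1} (\<lambda>t. t powr (a - 1) * (1 - t) powr (b - 1)) = Beta a b"
    using has_integral_Beta_real[OF assms(1,2)] by (rule integral_unique)
  then have "has_bochner_integral lborel
      (\<lambda>t. indicator {0..1} t *\<^sub>R (t powr (a - 1) * (1 - t) powr (b - 1))) (Beta a b)"
    using int set_borel_integral_eq_integral(2)[OF int]
    by (simp add: has_bochner_integral_iff set_integrable_def set_lebesgue_integral_def)
  then have "has_bochner_integral lborel
      (\<lambda>t. x powr (a + b - 2) * (indicator {0..1} t *\<^sub>R (t powr (a - 1) * (1 - t) powr (b - 1))))
      (x powr (a + b - 2) * Beta a b)"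
    by (rule has_bochner_integral_mult_right)
  also have "(\<lambda>t. x powr (a + b - 2) *
        (indicator {0..1} t *\<^sub>R (t powr (a - 1) * (1 - t) powr (b - 1))))
      = (\<lambda>t. indicator {0<..<x} (0 + x * t) *\<^sub>R
           ((0 + x * t) powr (a - 1) * (x - (0 + x * t)) powr (b - 1)))"
  proof
    fix t :: real
    \<comment> \<open>At the end points the closed and the open interval disagree, but the left side
      vanishes there anyway, since \<open>0 powr\<close> any exponent is 0.\<close>
    consider "t = 0 \<or> t = 1" | "0 < t \<and> t < 1" | "t < 0 \<or> t > 1"
      by linarith
    then show "x powr (a + b - 2) * (indicator {0..1} t *\<^sub>R (t powr (a - 1) * (1 - t) powr (b - 1)))
      = indicator {0<..<x} (0 + x * t) *\<^sub>R ((0 + x * t) powr (a - 1) * (x - (0 + x * t)) powr (b - 1))"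
    proof cases
      case 2
      have "x - x * t = x * (1 - t)" "x powr (a + b - 2) = x powr (a - 1) * x powr (b - 1)"
        by (simp_all add: algebra_simps flip: powr_add)
      then show ?thesis
        using 2 assms by (simp add: indicator_def powr_mult)
    next
      case 3
      then show ?thesis
        using assms by (auto simp: indicator_def zero_less_mult_iff)
    qed auto
  qed
  \<comment> \<open>The difference of one in the exponents is the Jacobian 1/x.\<close>
  also have "x powr (a + b - 2) * Beta a b = (x powr (a + b - 1) * Beta a b) /\<^sub>R \<bar>x\<bar>"
  proof -
    have "x powr (a + b - 1) = x powr (a + b - 2) * x"
      using \<open>x > 0\<close> powr_add[of x "a + b - 2" 1] by simp
    then show ?thesis
      using \<open>x > 0\<close> by simp
  qed
  finally show ?thesis
    using \<open>x > 0\<close> by (subst lborel_has_bochner_integral_real_affine_iff[where c = x and t = 0]) simp_all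
qed

text \<open>Let N be the ceiling of \<mu>. If e >= \<mu> then e - N > -1, so the Beta integral with
  parameters e + 1 - N and N - \<mu> converges when \<mu> < N. Its Gamma factors cancel against
  1/Gamma(N - \<mu>) and the quotient Gamma(e + 1)/Gamma(e + 1 - N) from the N-th derivative.
  Constants are killed since N >= 1.\<close>

lemma caputo_sum_powr:
  fixes c e :: "'i \<Rightarrow> real"
  assumes "finite A" and f: "\<And>x. x > 0 \<Longrightarrow> f x = (\<Sum>i\<in>A. c i * x powr e i)"
    and "\<mu> > 0" and e: "\<And>i. i \<in> A \<Longrightarrow> e i = 0 \<or> e i \<ge> \<mu>"
  shows "caputo_differentiable \<mu> f"
    and "x > 0 \<Longrightarrow> caputo \<mu> f x =
      (\<Sum>i\<in>A. if e i = 0 then 0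
                else c i * (Gamma (1 + e i) / Gamma (1 + e i - \<mu>)) * x powr (e i - \<mu>))"
proof -
  define N where "N = nat \<lceil>\<mu>\<rceil>"
  have N: "N > 0" "real N - 1 < \<mu>" "\<mu> \<le> real N"
    using \<open>\<mu> > 0\<close> unfolding N_def by linarith+
  define d where "d i = c i * pochhammer (e i + 1 - real N) N" for i
  have D: "(deriv ^^ N) f t = (\<Sum>i\<in>A. d i * t powr (e i - real N))" if "t > 0" for t
    unfolding d_def using higher_deriv_sum_powr(2)[of A f c e t N] assms(1) f that by blast
  \<comment> \<open>Here the product runs from 1 - N up to 0; the witness \<open>N - 1\<close> marks
    its zero factor.\<close>
  have d0: "d i = 0" if "e i = 0" for i
    using that N(1) by (auto simp: d_def pochhammer_eq_0_iff intro!: exI[of _ "N - 1"])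
  have d: "d i = c i * (Gamma (1 + e i) / Gamma (e i + 1 - real N))"
    if "e i \<noteq> 0" "i \<in> A" for i
  proof -
    have "e i + 1 - real N > 0"
      using e[OF that(2)] that N by auto
    then show ?thesis
      unfolding d_def by (subst pochhammer_Gamma) (auto elim!: nonpos_Ints_cases simp: add_ac)
  qed
  have bochner: "has_bochner_integral lborel
        (\<lambda>t. indicator {0<..<x} t *\<^sub>R caputo_kernel \<mu> f x t)
        (\<Sum>i\<in>A. d i * (x powr (e i - \<mu>) * Beta (e i + 1 - real N) (real N - \<mu>)))"
    if "x > 0" "\<mu> \<noteq> real N" for x
  proof -
    \<comment> \<open>For \<open>e i = 0\<close> the power t^(-N) is not integrable near 0, so the
      coefficient \<open>d i = 0\<close> must be multiplied in before integrating.\<close>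
    have power: "has_bochner_integral lborel
        (\<lambda>t. d i * (indicator {0<..<x} t *\<^sub>R (t powr (e i - real N) * (x - t) powr (real N - \<mu> - 1))))
        (d i * (x powr (e i - \<mu>) * Beta (e i + 1 - real N) (real N - \<mu>)))" if "i \<in> A" for i
    proof (cases "e i = 0")
      case False
      then have "e i + 1 - real N > 0" "real N - \<mu> > 0"
        using e[OF that] N \<open>\<mu> \<noteq> real N\<close> by auto
      from has_bochner_integral_Beta_scaled[OF this \<open>x > 0\<close>]
      have "has_bochner_integral lborel
        (\<lambda>t. indicator {0<..<x} t *\<^sub>R (t powr (e i - real N) * (x - t) powr (real N - \<mu> - 1)))
        (x powr (e i - \<mu>) * Beta (e i + 1 - real N) (real N - \<mu>))"
        by simp
      then show ?thesis
        by (rule has_bochner_integral_mult_right)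
    qed (simp add: d0 has_bochner_integral_zero)
    have eq: "indicator {0<..<x} t *\<^sub>R caputo_kernel \<mu> f x t =
      (\<Sum>i\<in>A. d i * (indicator {0<..<x} t *\<^sub>R (t powr (e i - real N) * (x - t) powr (real N - \<mu> - 1))))"
      for t
    proof (cases "0 < t \<and> t < x")
      case True
      have "1 / (x - t) powr (\<mu> + 1 - real N) = (x - t) powr (real N - \<mu> - 1)"
        by (simp flip: powr_minus_divide add: algebra_simps)
      then show ?thesis
        using True
        by (simp add: caputo_kernel_def D divide_inverse sum_distrib_left mult_ac flip: N_def)
    qed (auto simp: indicator_def)
    show ?thesis
      unfolding eq by (intro has_bochner_integral_sum power)
  qed
  show "caputo_differentiable \<mu> f"
    unfolding caputo_differentiable_def N_def[symmetric]
  proof (intro conjI allI impI)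
    fix k and x :: real
    assume "x > 0"
    show "(deriv ^^ k) f field_differentiable at x"
      using higher_deriv_sum_powr(1)[OF assms(1) f \<open>x > 0\<close>, of k]
      unfolding field_differentiable_def by blast
  next
    fix x :: real
    assume "\<mu> \<noteq> real N" "x > 0"
    then show "set_integrable lborel {0<..<x} (caputo_kernel \<mu> f x)"
      using bochner unfolding set_integrable_def has_bochner_integral_iff by blast
  qed
  show "caputo \<mu> f x =
      (\<Sum>i\<in>A. if e i = 0 then 0
                else c i * (Gamma (1 + e i) / Gamma (1 + e i - \<mu>)) * x powr (e i - \<mu>))"
    if "x > 0"
  proof (cases "\<mu> = real N")
    case True
    then have "caputo \<mu> f x = (deriv ^^ N) f x"
      by (simp add: caputo_def N_def)
    also have "\<dots> = (\<Sum>i\<in>A. d i * x powr (e i - real N))"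
      by (rule D[OF that])
    finally show ?thesis
      by (simp only:) (auto intro!: sum.cong simp: d0 d True add_ac)
  next
    case False
    have "(LINT \<tau>:{0<..<x}|lborel. caputo_kernel \<mu> f x \<tau>) =
        (\<Sum>i\<in>A. d i * (x powr (e i - \<mu>) * Beta (e i + 1 - real N) (real N - \<mu>)))"
      unfolding set_lebesgue_integral_def
      by (rule has_bochner_integral_integral_eq[OF bochner[OF that False]])
    then have "caputo \<mu> f x = 1 / Gamma (real N - \<mu>) *
        (\<Sum>i\<in>A. d i * (x powr (e i - \<mu>) * Beta (e i + 1 - real N) (real N - \<mu>)))"
      using False by (simp add: caputo_def N_def)
    also have "\<dots> = (\<Sum>i\<in>A. if e i = 0 then 0
                else c i * (Gamma (1 + e i) / Gamma (1 + e i - \<mu>)) * x powr (e i - \<mu>))"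
      unfolding sum_distrib_left
    proof (intro sum.cong refl)
      fix i assume "i \<in> A"
      have "Gamma (real N - \<mu>) \<noteq> 0"
        using N False by (intro less_imp_neq[OF Gamma_real_pos, symmetric]) auto
      moreover have "Gamma (e i + 1 - real N) \<noteq> 0" if "e i \<noteq> 0"
        using e[OF \<open>i \<in> A\<close>] that N by (intro less_imp_neq[OF Gamma_real_pos, symmetric]) auto
      ultimately show "1 / Gamma (real N - \<mu>) *
          (d i * (x powr (e i - \<mu>) * Beta (e i + 1 - real N) (real N - \<mu>)))
        = (if e i = 0 then 0
           else c i * (Gamma (1 + e i) / Gamma (1 + e i - \<mu>)) * x powr (e i - \<mu>))"
        using \<open>i \<in> A\<close> by (auto simp: d0 d Beta_def algebra_simps)
    qed
    finally show ?thesis .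
  qed
qed

text \<open>The Caputo derivative maps \<open>x\<^bsup>\<mu>j\<^esup>\<close> to \<open>caputo_factor \<mu> j\<close> times \<open>x\<^bsup>\<mu>(j-1)\<^esup>\<close>; constants are killed
  although the quotient of Gamma values need not vanish for \<open>j = 0\<close>.\<close>

definition caputo_factor :: "real \<Rightarrow> nat \<Rightarrow> real" where
  "caputo_factor \<mu> j =
     (if j = 0 then 0 else Gamma (1 + \<mu> * real j) / Gamma (1 + \<mu> * (real j - 1)))"

text \<open>The result is again a polynomial in \<open>x powr \<mu>\<close> on the positive reals,
  so the lemma applies to its own output and also handles the second Caputo derivative.\<close>

lemma caputo_poly_powr:
  assumes "\<mu> > 0" and f: "\<And>x. x > 0 \<Longrightarrow> f x = (\<Sum>j\<le>n. a j * (x powr \<mu>) ^ j)"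
  shows "caputo_differentiable \<mu> f"
    and "x > 0 \<Longrightarrow> caputo \<mu> f x = (\<Sum>j<n. a (Suc j) * caputo_factor \<mu> (Suc j) * (x powr \<mu>) ^ j)"
proof -
  have pow: "(x powr \<mu>) ^ j = x powr (\<mu> * real j)" if "x > 0" for x :: real and j
    using that by (simp add: powr_powr flip: powr_realpow)
  have f': "f x = (\<Sum>j\<le>n. a j * x powr (\<mu> * real j))" if "x > 0" for x
    using f pow that by simp
  have e: "\<mu> * real j = 0 \<or> \<mu> * real j \<ge> \<mu>" for j
    using \<open>\<mu> > 0\<close> by (cases j) (auto simp: algebra_simps)
  show "caputo_differentiable \<mu> f"
    by (rule caputo_sum_powr(1)[OF _ f' \<open>\<mu> > 0\<close> e]) auto
  assume "x > 0"
  have "caputo \<mu> f x = (\<Sum>j\<le>n. if \<mu> * real j = 0 then 0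
      else a j * (Gamma (1 + \<mu> * real j) / Gamma (1 + \<mu> * real j - \<mu>)) * x powr (\<mu> * real j - \<mu>))"
    by (rule caputo_sum_powr(2)[OF _ f' \<open>\<mu> > 0\<close> e \<open>x > 0\<close>]) auto
  also have "\<dots> = (\<Sum>j<n. a (Suc j) * caputo_factor \<mu> (Suc j) * (x powr \<mu>) ^ j)"
    using \<open>\<mu> > 0\<close>
    by (simp add: sum.atMost_shift caputo_factor_def pow[OF \<open>x > 0\<close>] algebra_simps)
  finally show "caputo \<mu> f x = (\<Sum>j<n. a (Suc j) * caputo_factor \<mu> (Suc j) * (x powr \<mu>) ^ j)" .
qed

section \<open>Monotonicity of Gamma quotients\<close>

text \<open>The logarithm of the quotient has derivative \<open>Digamma (t + h) - Digamma t\<close>,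
  which is positive because \<open>Digamma\<close> is strictly increasing on the positive
  reals.\<close>

lemma Gamma_ratio_strict_mono:
  fixes x y h :: real
  assumes "0 < x" "x < y" "h > 0"
  shows "Gamma (x + h) / Gamma x < Gamma (y + h) / Gamma y"
proof -
  have "ln_Gamma (x + h) - ln_Gamma x < ln_Gamma (y + h) - ln_Gamma y"
  proof (rule DERIV_pos_imp_increasing[OF \<open>x < y\<close>])
    fix t assume "x \<le> t" "t \<le> y"
    then show "\<exists>D. ((\<lambda>t. ln_Gamma (t + h) - ln_Gamma t) has_real_derivative D) (at t) \<and> D > 0"
      using assms
      by (intro exI[of _ "Digamma (t + h) - Digamma t"])
         (auto intro!: derivative_eq_intros Digamma_real_strict_mono)
  qed
  then have "exp (ln_Gamma (x + h) - ln_Gamma x) < exp (ln_Gamma (y + h) - ln_Gamma y)"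
    by simp
  then show ?thesis
    using assms by (simp add: exp_diff Gamma_real_pos_exp)
qed

lemma caputo_factor_pos:
  assumes "\<mu> > 0" "j > 0"
  shows "caputo_factor \<mu> j > 0"
proof -
  have "\<mu> * (real j - 1) \<ge> 0" "\<mu> * real j \<ge> 0"
    using assms by simp_all
  then show ?thesis
    using \<open>j > 0\<close> by (auto simp: caputo_factor_def intro!: divide_pos_pos Gamma_real_pos add_pos_nonneg)
qed

lemma caputo_factor_strict_mono:
  assumes "\<mu> > 0" "i < j"
  shows "caputo_factor \<mu> i < caputo_factor \<mu> j"
proof (cases "i = 0")
  case True
  then show ?thesis
    using caputo_factor_pos[of \<mu> j] assms by (simp add: caputo_factor_def)
next
  case False
  have "\<mu> * (real i - 1) \<ge> 0" "\<mu> * (real i - 1) < \<mu> * (real j - 1)"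
    using assms False by simp_all
  then have "Gamma (1 + \<mu> * (real i - 1) + \<mu>) / Gamma (1 + \<mu> * (real i - 1))
      < Gamma (1 + \<mu> * (real j - 1) + \<mu>) / Gamma (1 + \<mu> * (real j - 1))"
    using assms by (intro Gamma_ratio_strict_mono) auto
  then show ?thesis
    using False assms by (simp add: caputo_factor_def algebra_simps)
qed

section \<open>Eigenvalues and the closed forms of the coefficients\<close>

lemma Beta_conv_caputo_factor:
  assumes "\<mu> > 0"
  shows "Beta (1 + \<mu> * real j) \<mu> = Gamma \<mu> / caputo_factor \<mu> (Suc j)"
  using assms by (simp add: Beta_def caputo_factor_def algebra_simps)

text \<open>The operator \<open>x\<^bsup>2\<mu>\<^esup> D\<^sup>2 + 2 x\<^sup>\<mu> D\<close> acts on \<open>x\<^bsup>\<mu>j\<^esup>\<close> as multiplication by this number.\<close>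

definition bessel_eigenvalue :: "real \<Rightarrow> nat \<Rightarrow> real" where
  "bessel_eigenvalue \<mu> j = caputo_factor \<mu> j * caputo_factor \<mu> (j - 1) + 2 * caputo_factor \<mu> j"

text \<open>The product term is only weakly increasing: it is 0 at both 0 and 1. Strictness comes
  from the linear term.\<close>

lemma bessel_eigenvalue_strict_mono:
  assumes "\<mu> > 0" "i < j"
  shows "bessel_eigenvalue \<mu> i < bessel_eigenvalue \<mu> j"
proof -
  have nonneg: "caputo_factor \<mu> k \<ge> 0" for k
    using caputo_factor_pos[OF \<open>\<mu> > 0\<close>, of k] by (cases "k = 0") (auto simp: caputo_factor_def)
  have "caputo_factor \<mu> (i - 1) \<le> caputo_factor \<mu> (j - 1)"
    using strict_mono_less_eq[of "caputo_factor \<mu>" "i - 1" "j - 1"]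
      caputo_factor_strict_mono[OF \<open>\<mu> > 0\<close>] \<open>i < j\<close>
    by (simp add: strict_mono_def)
  moreover have "caputo_factor \<mu> i < caputo_factor \<mu> j"
    by (rule caputo_factor_strict_mono[OF assms])
  ultimately show ?thesis
    unfolding bessel_eigenvalue_def
    by (intro add_le_less_mono mult_mono) (auto simp: nonneg)
qed

text \<open>For \<open>k \<ge> 2\<close> both Beta values have the form Gamma(\<mu>) / r with r the
  factor at k - 1 or at k; inserting these clears all fractions except one Gamma(\<mu>).\<close>

lemma bessel_quot_conv_eigenvalue:
  assumes "\<mu> > 0" "k \<ge> 2"
  shows "bessel_quot \<mu> k = bessel_eigenvalue \<mu> k / Gamma \<mu>"
proof -
  obtain m where k: "k = Suc (Suc m)"
    using \<open>k \<ge> 2\<close> by (metis Suc_le_D numeral_2_eq_2 Suc_le_mono)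
  have B: "Beta (1 + \<mu> * (real k - 2)) \<mu> = Gamma \<mu> / caputo_factor \<mu> (Suc m)"
    "Beta (1 + \<mu> * (real k - 1)) \<mu> = Gamma \<mu> / caputo_factor \<mu> (Suc (Suc m))"
    using Beta_conv_caputo_factor[OF \<open>\<mu> > 0\<close>, of m]
      Beta_conv_caputo_factor[OF \<open>\<mu> > 0\<close>, of "Suc m"] by (simp_all add: k add_ac)
  have "caputo_factor \<mu> (Suc m) > 0" "caputo_factor \<mu> (Suc (Suc m)) > 0" "Gamma \<mu> > 0"
    using assms caputo_factor_pos by auto
  then show ?thesis
    unfolding bessel_quot_def B by (simp add: bessel_eigenvalue_def k divide_simps) (simp add: algebra_simps)
qed

lemma caputo_factor_1:
  assumes "\<mu> > 0"
  shows "caputo_factor \<mu> (Suc 0) = \<mu> * Gamma \<mu>"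
proof -
  have "\<mu> \<notin> \<int>\<^sub>\<le>\<^sub>0"
    using assms by (auto elim!: nonpos_Ints_cases)
  then show ?thesis
    using Gamma_plus1[of \<mu>] by (simp add: caputo_factor_def add_ac)
qed

text \<open>The right side is what two steps of the recurrence produce from \<open>a0\<close>, as
  the eigenvalue at 0 is 0. The last bracket of the closed form is the difference of eigenvalues up
  to a factor, and the product of the first two Caputo factors telescopes to Gamma(1 +
  2\<mu>).\<close>

lemma bessel_coeff2_conv_eigenvalue:
  assumes "\<mu> > 0" "n \<ge> 2"
  shows "bessel_coeff2 \<mu> n a0 = a0 * bessel_eigenvalue \<mu> n *
    (bessel_eigenvalue \<mu> n - bessel_eigenvalue \<mu> 1) /
    (4 * caputo_factor \<mu> 1 * caputo_factor \<mu> 2)"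
proof -
  define B1 where "B1 = Beta (1 + \<mu> * (real n - 1)) \<mu>"
  define B2 where "B2 = Beta (1 + \<mu> * (real n - 2)) \<mu>"
  have "\<mu> * (real n - 1) \<ge> 0" "\<mu> * (real n - 2) \<ge> 0"
    using assms by simp_all
  then have "B1 > 0" "B2 > 0"
    using assms unfolding B1_def B2_def Beta_def
    by (intro divide_pos_pos mult_pos_pos Gamma_real_pos; linarith)+
  define g h where "g = Gamma \<mu>" and "h = Gamma (1 + 2 * \<mu>)"
  have "g > 0" "h > 0"
    using assms by (simp_all add: g_def h_def)
  have G: "Gamma \<mu> > 0" "Gamma (1 + \<mu>) = \<mu> * Gamma \<mu>"
    using assms caputo_factor_1[of \<mu>] by (simp_all add: caputo_factor_def)
  have E: "bessel_eigenvalue \<mu> n = Gamma \<mu> * (Gamma \<mu> + 2 * B2) / (B1 * B2)"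
    using bessel_quot_conv_eigenvalue[OF assms] G
    by (simp add: bessel_quot_def B1_def B2_def field_simps)
  have E1: "bessel_eigenvalue \<mu> 1 = 2 * \<mu> * Gamma \<mu>"
    using caputo_factor_1[OF \<open>\<mu> > 0\<close>] by (simp add: bessel_eigenvalue_def caputo_factor_def)
  have F2: "caputo_factor \<mu> 2 = Gamma (1 + 2 * \<mu>) / (\<mu> * Gamma \<mu>)"
    using G by (simp add: caputo_factor_def mult_ac)
  have F1: "caputo_factor \<mu> 1 = \<mu> * Gamma \<mu>"
    using caputo_factor_1[OF \<open>\<mu> > 0\<close>] by simp
  \<comment> \<open>With the Gamma and Beta values named, a rational identity in
    \<open>\<mu>\<close>, \<open>g\<close>, \<open>h\<close>, \<open>B1\<close>, \<open>B2\<close>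
    remains.\<close>
  show ?thesis
    unfolding bessel_coeff2_def E E1 F1 F2 B1_def[symmetric] B2_def[symmetric]
      g_def[symmetric] h_def[symmetric]
    using assms \<open>g > 0\<close> \<open>h > 0\<close> \<open>B1 > 0\<close> \<open>B2 > 0\<close> by (simp add: field_simps power2_eq_square)
qed

section \<open>The coefficient recurrence\<close>

text \<open>The cases follow the closed forms: j = 0 tests the formula for the first coefficient, j
  = 1 the one for the second, and from j = 2 on each step appends one factor to the product.\<close>

lemma bessel_coeff_recurrence:
  assumes "\<mu> > 0" "n \<ge> 2" "j < n"
  shows "2 * caputo_factor \<mu> (Suc j) * bessel_coeff \<mu> n a0 (Suc j) =
    (bessel_eigenvalue \<mu> n - bessel_eigenvalue \<mu> j) * bessel_coeff \<mu> n a0 j"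
proof -
  have pos: "Gamma \<mu> \<noteq> 0" "caputo_factor \<mu> (Suc 0) > 0" "caputo_factor \<mu> 2 > 0"
      "caputo_factor \<mu> (Suc j) > 0"
    using assms caputo_factor_pos less_imp_neq[OF Gamma_real_pos[OF \<open>\<mu> > 0\<close>]] by auto
  consider "j = 0" | "j = 1" | "j \<ge> 2" by linarith
  then show ?thesis
  proof cases
    case 1
    then show ?thesis
      using assms pos
      by (simp add: bessel_coeff_def bessel_quot_conv_eigenvalue caputo_factor_1
          bessel_eigenvalue_def[of \<mu> 0] caputo_factor_def[of \<mu> 0])
  next
    case 2
    have c1: "bessel_coeff \<mu> n a0 (Suc 0) = a0 * bessel_eigenvalue \<mu> n / (2 * caputo_factor \<mu> (Suc 0))"
      using assms pos by (simp add: bessel_coeff_def bessel_quot_conv_eigenvalue caputo_factor_1)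
    have c2: "bessel_coeff \<mu> n a0 (Suc (Suc 0)) = a0 * bessel_eigenvalue \<mu> n *
        (bessel_eigenvalue \<mu> n - bessel_eigenvalue \<mu> (Suc 0)) /
        (4 * caputo_factor \<mu> (Suc 0) * caputo_factor \<mu> (Suc (Suc 0)))"
      using bessel_coeff2_conv_eigenvalue[OF assms(1,2), of a0]
      by (simp add: bessel_coeff_def numeral_2_eq_2)
    show ?thesis
      unfolding 2 One_nat_def c1 c2 using pos(2,3) by (simp add: numeral_2_eq_2 divide_simps)
  next
    case 3
    define P where "P i = Beta (1 + \<mu> * real i) \<mu> / 2 * (bessel_quot \<mu> n - bessel_quot \<mu> i)" for i
    \<comment> \<open>For k = 2 the product is empty, so one formula covers the second coefficient
      too.\<close>
    have coeff: "bessel_coeff \<mu> n a0 k = bessel_coeff2 \<mu> n a0 * (\<Prod>i=2..k-1. P i)" if "k \<ge> 2" for k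
      using that by (simp add: bessel_coeff_def P_def)
    have "(\<Prod>i=2..Suc j - 1. P i) = (\<Prod>i=2..j-1. P i) * P j"
      using 3 prod.nat_ivl_Suc'[of 2 "j - 1" P] by (simp add: mult_ac)
    then have "bessel_coeff \<mu> n a0 (Suc j) = bessel_coeff \<mu> n a0 j * P j"
      using 3 by (simp add: coeff)
    moreover have "2 * caputo_factor \<mu> (Suc j) * P j = bessel_eigenvalue \<mu> n - bessel_eigenvalue \<mu> j"
      using assms 3 pos
      by (simp add: P_def Beta_conv_caputo_factor bessel_quot_conv_eigenvalue field_simps)
    ultimately show ?thesis
      by (metis mult.assoc mult.commute)
  qed
qed

text \<open>For \<open>n \<ge> 2\<close> the recurrence multiplies by a nonzero difference of
  eigenvalues as long as j < n. At j = n the difference vanishes, which is why the solution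
  terminates there.\<close>

lemma bessel_coeff_nonzero:
  assumes "\<mu> > 0" "a0 \<noteq> 0" "j \<le> n"
  shows "bessel_coeff \<mu> n a0 j \<noteq> 0"
proof (cases "n \<ge> 2")
  case True
  show ?thesis
    using \<open>j \<le> n\<close>
  proof (induction j)
    case 0
    then show ?case using assms by (simp add: bessel_coeff_def)
  next
    case (Suc j)
    then show ?case
      using bessel_coeff_recurrence[OF \<open>\<mu> > 0\<close> True, of j a0]
        bessel_eigenvalue_strict_mono[OF \<open>\<mu> > 0\<close>, of j n] by auto
  qed
next
  case False
  then have "j = 0 \<or> j = 1 \<and> n = 1"
    using \<open>j \<le> n\<close> by linarith
  then show ?thesis
    using assms by (auto simp: bessel_coeff_def)
qed

section \<open>The differential equation\<close>

lemma frac_bessel_eq_poly: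
  assumes "x > 0"
  shows "frac_bessel \<mu> n a0 x = (\<Sum>j\<le>n. bessel_coeff \<mu> n a0 j * (x powr \<mu>) ^ j)"
  using assms
  by (simp add: frac_bessel_def atLeast0AtMost powr_powr flip: powr_realpow)

text \<open>Here z stands for x^\<mu>. Written as sums over j <= n, the terms with z^2, 2z and 2
  contribute \<open>b j * b (j - 1)\<close>, \<open>2 * b j\<close> and, by the recurrence,
  \<open>l n - l j\<close> to the coefficient of \<open>a j * z ^ j\<close>. These add up to
  \<open>l n\<close>.\<close>

lemma frac_bessel_equation:
  fixes a b :: "nat \<Rightarrow> real" and z :: real
  assumes "n \<ge> 1" "b 0 = 0"
    and rec: "\<And>j. j < n \<Longrightarrow> 2 * b (Suc j) * a (Suc j) = (l n - l j) * a j"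
    and l: "\<And>j. l j = b j * b (j - 1) + 2 * b j"
  shows "z\<^sup>2 * (\<Sum>j<n - 1. a (Suc (Suc j)) * b (Suc (Suc j)) * b (Suc j) * z ^ j)
    + 2 * (z + 1) * (\<Sum>j<n. a (Suc j) * b (Suc j) * z ^ j) - l n * (\<Sum>j\<le>n. a j * z ^ j) = 0"
proof -
  obtain m where n: "n = Suc m"
    using \<open>n \<ge> 1\<close> by (cases n) auto
  \<comment> \<open>The terms for j = 0 and j = 1 both contain \<open>b 0\<close>, so the index can
    shift by two.\<close>
  have "(\<Sum>j\<le>n. a j * b j * b (j - 1) * z ^ j)
      = (\<Sum>j<m. a (Suc (Suc j)) * b (Suc (Suc j)) * b (Suc j) * z ^ Suc (Suc j))"
    using \<open>b 0 = 0\<close> by (simp add: n sum.atMost_shift sum.lessThan_Suc_shift del: sum.lessThan_Suc)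
  then have D2: "z\<^sup>2 * (\<Sum>j<n - 1. a (Suc (Suc j)) * b (Suc (Suc j)) * b (Suc j) * z ^ j)
      = (\<Sum>j\<le>n. a j * b j * b (j - 1) * z ^ j)"
    by (simp add: n sum_distrib_left power2_eq_square mult_ac)
  have zD: "z * (\<Sum>j<n. a (Suc j) * b (Suc j) * z ^ j) = (\<Sum>j\<le>n. a j * b j * z ^ j)"
    using \<open>b 0 = 0\<close> by (simp add: sum.atMost_shift sum_distrib_left mult_ac)
  have "2 * (\<Sum>j<n. a (Suc j) * b (Suc j) * z ^ j) = (\<Sum>j<n. (l n - l j) * a j * z ^ j)"
    unfolding sum_distrib_left using rec by (intro sum.cong) (auto simp: mult_ac)
  \<comment> \<open>The added term j = n has the factor \<open>l n - l n\<close>.\<close>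
  also have "\<dots> = (\<Sum>j\<le>n. (l n - l j) * a j * z ^ j)"
    by (simp flip: lessThan_Suc_atMost)
  finally have D: "2 * (\<Sum>j<n. a (Suc j) * b (Suc j) * z ^ j)
      = (\<Sum>j\<le>n. (l n - l j) * a j * z ^ j)" .
  have "z\<^sup>2 * (\<Sum>j<n - 1. a (Suc (Suc j)) * b (Suc (Suc j)) * b (Suc j) * z ^ j)
      + 2 * (z + 1) * (\<Sum>j<n. a (Suc j) * b (Suc j) * z ^ j) - l n * (\<Sum>j\<le>n. a j * z ^ j)
    = (\<Sum>j\<le>n. a j * b j * b (j - 1) * z ^ j) + 2 * (\<Sum>j\<le>n. a j * b j * z ^ j)
      + (\<Sum>j\<le>n. (l n - l j) * a j * z ^ j) - l n * (\<Sum>j\<le>n. a j * z ^ j)"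
    unfolding D2[symmetric] zD[symmetric] D[symmetric] by (simp add: algebra_simps)
  also have "\<dots> = (\<Sum>j\<le>n. a j * b j * b (j - 1) * z ^ j + 2 * (a j * b j * z ^ j)
      + (l n - l j) * a j * z ^ j - l n * (a j * z ^ j))"
    by (simp add: sum.distrib sum_subtractf sum_distrib_left)
  also have "\<dots> = 0"
    by (intro sum.neutral) (auto simp: l algebra_simps)
  finally show ?thesis .
qed

theorem corollary4:
  fixes \<mu> a0 :: real and n :: nat
  assumes "\<mu> \<in> \<rat>" and "\<mu> > 0" and "a0 \<noteq> 0" and "n \<ge> 1"
  shows "(\<exists>p :: real poly. degree p = n \<and> (\<forall>x>0. frac_bessel \<mu> n a0 x = poly p (x powr \<mu>))) \<and>
    caputo_differentiable \<mu> (frac_bessel \<mu> n a0) \<and>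
    (n = 1 \<longrightarrow>
      (\<forall>x>0. (x powr \<mu> + 1) * caputo \<mu> (frac_bessel \<mu> n a0) x
             - Gamma (1 + \<mu>) * frac_bessel \<mu> n a0 x = 0)) \<and>
    (n \<ge> 2 \<longrightarrow>
      caputo_differentiable \<mu> (caputo \<mu> (frac_bessel \<mu> n a0)) \<and>
      (\<forall>x>0. x powr (2 * \<mu>) * caputo \<mu> (caputo \<mu> (frac_bessel \<mu> n a0)) x
             + 2 * (x powr \<mu> + 1) * caputo \<mu> (frac_bessel \<mu> n a0) x
             - Gamma \<mu> * (Gamma \<mu> + 2 * Beta (1 + \<mu> * (real n - 2)) \<mu>) /
                 (Beta (1 + \<mu> * (real n - 1)) \<mu> * Beta (1 + \<mu> * (real n - 2)) \<mu>)
               * frac_bessel \<mu> n a0 x = 0))"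
proof -
  let ?y = "frac_bessel \<mu> n a0" and ?a = "bessel_coeff \<mu> n a0" and ?b = "caputo_factor \<mu>"
  note y = frac_bessel_eq_poly[of _ \<mu> n a0]
  have Dy: "caputo_differentiable \<mu> ?y"
    "x > 0 \<Longrightarrow> caputo \<mu> ?y x = (\<Sum>j<n. ?a (Suc j) * ?b (Suc j) * (x powr \<mu>) ^ j)" for x
    using caputo_poly_powr[OF \<open>\<mu> > 0\<close>, of ?y] y by blast+
  let ?p = "\<Sum>j\<le>n. monom (?a j) j"
  have "coeff ?p n \<noteq> 0"
    using bessel_coeff_nonzero[OF \<open>\<mu> > 0\<close> \<open>a0 \<noteq> 0\<close>, of n n] by (simp add: coeff_sum)
  moreover have "degree ?p \<le> n"
    by (intro degree_sum_le) (auto intro: order.trans[OF degree_monom_le])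
  ultimately have "degree ?p = n"
    using le_degree[of ?p n] by simp
  moreover have "\<forall>x>0. ?y x = poly ?p (x powr \<mu>)"
    by (simp add: y poly_sum poly_monom)
  \<comment> \<open>For n = 1 the function is a0 (1 + x^\<mu>), whose Caputo derivative is the
    constant a0 Gamma(1 + \<mu>).\<close>
  moreover have "(x powr \<mu> + 1) * caputo \<mu> ?y x - Gamma (1 + \<mu>) * ?y x = 0"
    if "n = 1" "x > 0" for x
    using that Dy(2)[OF \<open>x > 0\<close>] y[OF \<open>x > 0\<close>]
    by (simp add: bessel_coeff_def caputo_factor_def algebra_simps)
  moreover have "caputo_differentiable \<mu> (caputo \<mu> ?y) \<and>
      x powr (2 * \<mu>) * caputo \<mu> (caputo \<mu> ?y) x + 2 * (x powr \<mu> + 1) * caputo \<mu> ?y x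
        - Gamma \<mu> * (Gamma \<mu> + 2 * Beta (1 + \<mu> * (real n - 2)) \<mu>) /
            (Beta (1 + \<mu> * (real n - 1)) \<mu> * Beta (1 + \<mu> * (real n - 2)) \<mu>) * ?y x = 0"
    if "n \<ge> 2" "x > 0" for x
  proof -
    \<comment> \<open>This gives the first derivative the shape that \<open>caputo_poly_powr\<close>
      expects.\<close>
    have "{..<n} = {..n - 1}"
      using \<open>n \<ge> 1\<close> by auto
    then have "caputo \<mu> ?y t = (\<Sum>j\<le>n - 1. ?a (Suc j) * ?b (Suc j) * (t powr \<mu>) ^ j)" if "t > 0" for t
      using Dy(2)[OF that] by simp
    from caputo_poly_powr[OF \<open>\<mu> > 0\<close> this]
    have DDy: "caputo_differentiable \<mu> (caputo \<mu> ?y)"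
      "caputo \<mu> (caputo \<mu> ?y) x = (\<Sum>j<n - 1.
         ?a (Suc (Suc j)) * ?b (Suc (Suc j)) * ?b (Suc j) * (x powr \<mu>) ^ j)"
      using \<open>x > 0\<close> by simp_all
    have "Gamma \<mu> > 0"
      using \<open>\<mu> > 0\<close> by simp
    then have l: "Gamma \<mu> * (Gamma \<mu> + 2 * Beta (1 + \<mu> * (real n - 2)) \<mu>) /
        (Beta (1 + \<mu> * (real n - 1)) \<mu> * Beta (1 + \<mu> * (real n - 2)) \<mu>) = bessel_eigenvalue \<mu> n"
      using bessel_quot_conv_eigenvalue[OF \<open>\<mu> > 0\<close> \<open>n \<ge> 2\<close>]
      by (simp add: bessel_quot_def eq_divide_eq mult_ac)
    have "x powr (2 * \<mu>) = (x powr \<mu>)\<^sup>2"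
      by (simp add: power2_eq_square flip: powr_add)
    moreover have "(x powr \<mu>)\<^sup>2 *
          (\<Sum>j<n - 1. ?a (Suc (Suc j)) * ?b (Suc (Suc j)) * ?b (Suc j) * (x powr \<mu>) ^ j)
        + 2 * (x powr \<mu> + 1) * (\<Sum>j<n. ?a (Suc j) * ?b (Suc j) * (x powr \<mu>) ^ j)
        - bessel_eigenvalue \<mu> n * (\<Sum>j\<le>n. ?a j * (x powr \<mu>) ^ j) = 0"
      using \<open>n \<ge> 1\<close> bessel_coeff_recurrence[OF \<open>\<mu> > 0\<close> \<open>n \<ge> 2\<close>]
      by (intro frac_bessel_equation) (auto simp: caputo_factor_def[of \<mu> 0] bessel_eigenvalue_def)
    ultimately show ?thesis
      unfolding l using DDy(1) DDy(2) Dy(2)[OF \<open>x > 0\<close>] y[OF \<open>x > 0\<close>] by simp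
  qed
  \<comment> \<open>Differentiability was proved together with the equation at a point x > 0; the
    point 1 releases it from x.\<close>
  then have "n \<ge> 2 \<longrightarrow> caputo_differentiable \<mu> (caputo \<mu> ?y) \<and>
      (\<forall>x>0. x powr (2 * \<mu>) * caputo \<mu> (caputo \<mu> ?y) x + 2 * (x powr \<mu> + 1) * caputo \<mu> ?y x
        - Gamma \<mu> * (Gamma \<mu> + 2 * Beta (1 + \<mu> * (real n - 2)) \<mu>) /
            (Beta (1 + \<mu> * (real n - 1)) \<mu> * Beta (1 + \<mu> * (real n - 2)) \<mu>) * ?y x = 0)"
    using zero_less_one by blast
  ultimately show ?thesis
    using Dy(1) by blast
qed

end
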